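(* Suppose $\widehat H\in\mathcal A^\rho\cap\mathcal F_\diamond$ and $\|\widehat H\|_\rho=h\rho^3$. Then for any $\delta\ge0$ $$\mathcal H(\cdot,\delta)=\sum_{\mathbf k\in\mathbb Z^{2n}_\diamond}\mathcal H_{\mathbf k}(\delta)\,\mathbf z^{\mathbf k}\in\mathcal A^{g(\delta)}\cap\mathcal F_\diamond,$$ where for some constants $A,B>0$, depending on $\rho,h$ and $n$, $$g(\delta)\ge\frac{A}{1+B\delta}.$$ More precisely, $$|\mathcal H|\le\frac{h\rho^3}{4(1+32nh\rho\delta)^3}\quad\text{in the domain}\quad\Big\{\mathbf z\in\mathbb C^{2n}:|\mathbf z|\le\frac{\rho}{4(1+32nh\rho\delta)}\Big\}.$$
   Context: Fix $n\ge1$ and a vector $\omega\in\mathbb R^n$. $\mathbb Z_+=\{0,1,2,\dots\}$. For $\mathbf k=(k,\overline k)\in\mathbb Z_+^{2n}$, with $k,\overline k\in\mathbb Z_+^n$, put $|\mathbf k|=\sum_j(k_j+\overline k_j)$ and $\mathbf k'=\overline k-k\in\mathbb Z^n$. Put $\mathbb Z^{2n}_\diamond=\{\mathbf k\in\mathbb Z_+^{2n}:|\mathbf k|\ge3\}$. For $q\in\mathbb Z^n$ put $\sigma_q=\operatorname{sign}\langle\omega,q\rangle\in\{-1,0,1\}$ and $\omega_q=|\langle\omega,q\rangle|$. The variables $\mathbf z=(z,\overline z)=(z_1,\dots,z_n,\overline z_1,\dots,\overline z_n)$ are $2n$ independent complex variables (the bar is not conjugation), and $\mathbf z^{\mathbf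 k}=z^k\overline z^{\overline k}$; $|\mathbf z|=\sum_j(|z_j|+|\overline z_j|)$ is the $l^1$-norm. $\mathcal F=\mathbb C[[z,\overline z]]$ is the space of formal power series $H=\sum_{\mathbf k}H_{\mathbf k}\mathbf z^{\mathbf k}$; $\mathcal F_\diamond\subset\mathcal F$ is the subspace of series with $H_{\mathbf k}=0$ for $|\mathbf k|\le2$. For $\rho>0$ put $D_\rho=\{\mathbf z\in\mathbb C^{2n}:|z_j|<\rho,\ |\overline z_j|<\rho,\ j=1,\dots,n\}$ and let $\mathcal A^\rho$ be the Banach space of power series in $\mathcal F$ that define bounded analytic functions on $D_\rho$, with norm $\|H\|_\rho=\sup_{D_\rho}|H|$. The Poisson bracket is $\{F,G\}=i\sum_{j=1}^n(\partial_{\overline z_j}F\,\partial_{z_j}G-\partial_{z_j}F\,\partial_{\overline z_j}G)$, and $H_2=\sum_{j=1}^n\omega_jz_j\overline z_j$. The operator $\xi_*$ on $\mathcal F_\diamond$ is $\xi_*H=-i\sum_{\mathbf k\in\mathbb Z^{2n}_\diamond}\sigma_{\mathbf k'}H_{\mathbf k}\mathbf z^{\mathbf k}$. For $\widehat H\in\mathcal F_\diamond$ let $H(\cdot,\delta)=\sum_{\mathbf k}H_{\mathbf k}(\delta)\mathbf z^{\mathbf k}$ be the (unique, existing for all $\delta\in\mathbb R$) solution of the initial value problem in $\mathcal F_\diamond$, understood coefficientwise, $$\partial_\delta H=-\{\xi_*H,\,H_2+H\},\qquad H|_{\delta=0}=\widehat H,$$ and put $\mathcal H_{\mathbf k}(\delta)=H_{\mathbf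 k}(\delta)\,e^{\omega_{\mathbf k'}\delta}$. *)

theory Defs
  imports "HOL-Analysis.Analysis"
begin

text \<open>
  The index type \<open>'n\<close> plays the role of \<open>{1..n}\<close>, so \<open>n = CARD('n)\<close>.  A pair \<open>k\<close> of
  multi-indices stands for \<open>(fst k, snd k)\<close>, the exponents of the variables \<open>z\<close> and of the
  independent variables written with a bar.  A formal power series is its family of coefficients.
\<close>

type_synonym 'n mindex = "(nat ^ 'n) \<times> (nat ^ 'n)"
type_synonym 'n fseries = "'n mindex \<Rightarrow> complex"
type_synonym 'n zvec = "(complex ^ 'n) \<times> (complex ^ 'n)"

definition mdeg :: "'n::finite mindex \<Rightarrow> nat" where
  "mdeg k = (\<Sum>j\<in>UNIV. fst k $ j + snd k $ j)"

definition mdiff :: "'n::finite mindex \<Rightarrow> int ^ 'n" where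
  "mdiff k = (\<chi> j. int (snd k $ j) - int (fst k $ j))"

definition pairing :: "real ^ 'n \<Rightarrow> int ^ 'n::finite \<Rightarrow> real" where
  "pairing \<omega> q = (\<Sum>j\<in>UNIV. \<omega> $ j * of_int (q $ j))"

definition sigma :: "real ^ 'n \<Rightarrow> int ^ 'n::finite \<Rightarrow> real" where
  "sigma \<omega> q = sgn (pairing \<omega> q)"

definition freq :: "real ^ 'n \<Rightarrow> int ^ 'n::finite \<Rightarrow> real" where
  "freq \<omega> q = \<bar>pairing \<omega> q\<bar>"

definition F_diamond :: "'n::finite fseries set" where
  "F_diamond = {H. \<forall>k. mdeg k \<le> 2 \<longrightarrow> H k = 0}"

definition fs_add :: "'n::finite fseries \<Rightarrow> 'n fseries \<Rightarrow> 'n fseries" where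
  "fs_add F G = (\<lambda>k. F k + G k)"

text \<open>Cauchy product; the index set is finite by \<open>finite_mindex_splits\<close> below.\<close>

definition fs_mult :: "'n::finite fseries \<Rightarrow> 'n fseries \<Rightarrow> 'n fseries" where
  "fs_mult F G = (\<lambda>k. \<Sum>(l, m)\<in>{(l, m). l + m = k}. F l * G m)"

lemma finite_mindex_splits: "finite {(l, m). l + m = (k :: 'n::finite mindex)}"
proof -
  let ?B = "{v :: nat ^ 'n. \<forall>j. v $ j \<in> {..mdeg k}}"
  have "?B \<subseteq> vec_lambda ` (PiE UNIV (\<lambda>_. {..mdeg k}))"
  proof
    fix v :: "nat ^ 'n" assume "v \<in> ?B"
    then have "vec_nth v \<in> PiE UNIV (\<lambda>_. {..mdeg k})" by auto
    then have "vec_lambda (vec_nth v) \<in> vec_lambda ` (PiE UNIV (\<lambda>_. {..mdeg k}))" by (rule imageI)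
    then show "v \<in> vec_lambda ` (PiE UNIV (\<lambda>_. {..mdeg k}))" by simp
  qed
  moreover have "finite (vec_lambda ` (PiE (UNIV :: 'n set) (\<lambda>_. {..mdeg k})))"
    by (intro finite_imageI finite_PiE) auto
  ultimately have B: "finite ?B" by (rule finite_subset)
  have le: "fst k $ j + snd k $ j \<le> mdeg k" for j
    unfolding mdeg_def by (rule member_le_sum) auto
  have "{(l, m). l + m = k} \<subseteq> (?B \<times> ?B) \<times> (?B \<times> ?B)"
  proof
    fix p assume "p \<in> {(l, m). l + m = k}"
    then obtain a b c d where p: "p = ((a, b), (c, d))" and eq: "(a, b) + (c, d) = k"
      by (cases p) auto
    have "fst k $ j = a $ j + c $ j" "snd k $ j = b $ j + d $ j" for j
      using eq by auto
    then have "a $ j \<le> mdeg k \<and> b $ j \<le> mdeg k \<and> c $ j \<le> mdeg k \<and> d $ j \<le> mdeg k" for j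
      using le[of j] by simp
    then show "p \<in> (?B \<times> ?B) \<times> (?B \<times> ?B)" by (simp add: p)
  qed
  then show ?thesis by (rule finite_subset) (use B in auto)
qed

definition dz :: "'n::finite \<Rightarrow> 'n fseries \<Rightarrow> 'n fseries" where
  "dz j F = (\<lambda>k. of_nat (fst k $ j + 1) * F (k + (axis j 1, 0)))"

definition dzbar :: "'n::finite \<Rightarrow> 'n fseries \<Rightarrow> 'n fseries" where
  "dzbar j F = (\<lambda>k. of_nat (snd k $ j + 1) * F (k + (0, axis j 1)))"

definition poisson :: "'n::finite fseries \<Rightarrow> 'n fseries \<Rightarrow> 'n fseries" where
  "poisson F G = (\<lambda>k. \<i> * (\<Sum>j\<in>UNIV.
     fs_mult (dzbar j F) (dz j G) k - fs_mult (dz j F) (dzbar j G) k))"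

definition H2 :: "real ^ 'n::finite \<Rightarrow> 'n fseries" where
  "H2 \<omega> = (\<lambda>k. \<Sum>j\<in>UNIV. if k = (axis j 1, axis j 1) then of_real (\<omega> $ j) else 0)"

definition xi :: "real ^ 'n::finite \<Rightarrow> 'n fseries \<Rightarrow> 'n fseries" where
  "xi \<omega> H = (\<lambda>k. if 3 \<le> mdeg k then - \<i> * of_real (sigma \<omega> (mdiff k)) * H k else 0)"

definition flow_solution :: "real ^ 'n::finite \<Rightarrow> 'n fseries \<Rightarrow> (real \<Rightarrow> 'n fseries) \<Rightarrow> bool" where
  "flow_solution \<omega> Hhat H \<longleftrightarrow>
     (\<forall>\<delta>. H \<delta> \<in> F_diamond) \<and> H 0 = Hhat \<and>
     (\<forall>\<delta> k. ((\<lambda>s. H s k) has_vector_derivative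
        - poisson (xi \<omega> (H \<delta>)) (fs_add (H2 \<omega>) (H \<delta>)) k) (at \<delta>))"

definition rescaled :: "real ^ 'n::finite \<Rightarrow> (real \<Rightarrow> 'n fseries) \<Rightarrow> real \<Rightarrow> 'n fseries" where
  "rescaled \<omega> H \<delta> = (\<lambda>k. H \<delta> k * of_real (exp (freq \<omega> (mdiff k) * \<delta>)))"

definition zmonom :: "'n::finite zvec \<Rightarrow> 'n mindex \<Rightarrow> complex" where
  "zmonom z k = (\<Prod>j\<in>UNIV. fst z $ j ^ (fst k $ j) * snd z $ j ^ (snd k $ j))"

definition l1norm :: "'n::finite zvec \<Rightarrow> real" where
  "l1norm z = (\<Sum>j\<in>UNIV. cmod (fst z $ j) + cmod (snd z $ j))"

definition fs_converges :: "'n::finite fseries \<Rightarrow> 'n zvec \<Rightarrow> bool" where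
  "fs_converges H z \<longleftrightarrow> (\<lambda>k. H k * zmonom z k) summable_on UNIV"

definition fs_eval :: "'n::finite fseries \<Rightarrow> 'n zvec \<Rightarrow> complex" where
  "fs_eval H z = (\<Sum>\<^sub>\<infinity>k. H k * zmonom z k)"

definition polydisc :: "real \<Rightarrow> 'n::finite zvec set" where
  "polydisc \<rho> = {z. \<forall>j. cmod (fst z $ j) < \<rho> \<and> cmod (snd z $ j) < \<rho>}"

text \<open>
  A power series defines an analytic function on a polydisc centred at the origin exactly when it
  converges (then absolutely) at each of its points; analyticity of the sum is automatic.
\<close>

definition A_space :: "real \<Rightarrow> 'n::finite fseries set" where
  "A_space \<rho> = {H. (\<forall>z\<in>polydisc \<rho>. fs_converges H z) \<and> bounded (fs_eval H ` polydisc \<rho>)}"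

text \<open>Meaningful only for members of \<open>A_space \<rho>\<close> with \<open>\<rho> > 0\<close>.\<close>

definition A_norm :: "real \<Rightarrow> 'n::finite fseries \<Rightarrow> real" where
  "A_norm \<rho> H = (SUP z\<in>polydisc \<rho>. cmod (fs_eval H z))"

end

theory Submission
  imports Defs
begin

text \<open>
  Coefficientwise, the rescaled unknowns satisfy a quadratic equation in which every exponential
  factor is at most 1, because \<open>freq\<close> is subadditive.  Hence they are dominated by any series with
  nonnegative coefficients that dominates the initial value and satisfies
  \<open>\<partial>\<^sub>\<delta> f \<ge> 2 \<Sum>\<^sub>j \<partial>f/\<partial>z\<^sub>j \<partial>f/\<partial>zbar\<^sub>j\<close> coefficientwise.  Searching for \<open>f\<close> as a function of the
  single variable \<open>s = \<Sum>\<^sub>j (z\<^sub>j + zbar\<^sub>j)\<close> reduces this to \<open>\<partial>\<^sub>\<delta> f \<ge> 2 n f'(s)\<^sup>2\<close>, which is solved by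
  \<open>f = \<Sum>\<^sub>m h d\<^bsub>m-3\<^esub>/m (T/\<rho>)\<^bsup>m-3\<^esup> s\<^sup>m\<close> with \<open>T = 1 + 32 n h \<rho> \<delta>\<close> and \<open>d\<^sub>j\<close> four times the \<open>j\<close>-th Catalan number.
  The Cauchy estimates provide the domination at \<open>\<delta> = 0\<close>.
\<close>

section \<open>Multi-indices and multinomial coefficients\<close>

text \<open>Otherwise sums of multi-indices given as pairs are evaluated before \<open>mdeg_add\<close> applies.\<close>

declare add_Pair [simp del]

text \<open>The sum type \<open>'n + 'n\<close> indexes all 2n variables at once, \<open>Inl\<close>
  for z and \<open>Inr\<close> for the barred ones, so that the two halves need no separate
  treatment.\<close>

definition expo :: "'n::finite mindex \<Rightarrow> 'n + 'n \<Rightarrow> nat" where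
  "expo k i = (case i of Inl j \<Rightarrow> fst k $ j | Inr j \<Rightarrow> snd k $ j)"

definition munit :: "'n::finite + 'n \<Rightarrow> 'n mindex" where
  "munit i = (case i of Inl j \<Rightarrow> (axis j 1, 0) | Inr j \<Rightarrow> (0, axis j 1))"

definition zcoord :: "'n::finite zvec \<Rightarrow> 'n + 'n \<Rightarrow> complex" where
  "zcoord z i = (case i of Inl j \<Rightarrow> fst z $ j | Inr j \<Rightarrow> snd z $ j)"

lemma expo_simps [simp]:
  "expo k (Inl j) = fst k $ j" "expo k (Inr j) = snd k $ j"
  by (simp_all add: expo_def)

lemma expo_add [simp]: "expo (k + l) i = expo k i + expo l i"
  by (cases i) auto

lemma expo_0 [simp]: "expo 0 i = 0"
  by (cases i) auto

lemma expo_munit [simp]: "expo (munit i) i' = of_bool (i = i')"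
  by (cases i; cases i') (auto simp: munit_def axis_def)

lemma expo_eq_iff: "k = l \<longleftrightarrow> (\<forall>i. expo k i = expo l i)"
proof
  assume "\<forall>i. expo k i = expo l i"
  then have "fst k $ j = fst l $ j \<and> snd k $ j = snd l $ j" for j
    by (metis expo_simps)
  then show "k = l" by (simp add: prod_eq_iff vec_eq_iff)
qed auto

lemma sum_UNIV_Plus:
  "(\<Sum>i\<in>(UNIV :: ('a::finite + 'b::finite) set). f i)
    = (\<Sum>j\<in>UNIV. f (Inl j)) + (\<Sum>j\<in>UNIV. f (Inr j))"
  by (simp add: UNIV_Plus_UNIV [symmetric] sum.Plus del: UNIV_Plus_UNIV)

lemma prod_UNIV_Plus:
  "(\<Prod>i\<in>(UNIV :: ('a::finite + 'b::finite) set). f i)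
    = (\<Prod>j\<in>UNIV. f (Inl j)) * (\<Prod>j\<in>UNIV. f (Inr j))"
  by (simp add: UNIV_Plus_UNIV [symmetric] prod.Plus del: UNIV_Plus_UNIV)

lemma mdeg_eq_sum_expo: "mdeg k = (\<Sum>i\<in>UNIV. expo k i)"
  by (simp add: mdeg_def sum_UNIV_Plus sum.distrib)

lemma zmonom_eq_prod: "zmonom z k = (\<Prod>i\<in>UNIV. zcoord z i ^ expo k i)"
  by (simp add: zmonom_def prod_UNIV_Plus prod.distrib zcoord_def)

lemma l1norm_eq_sum: "l1norm z = (\<Sum>i\<in>UNIV. cmod (zcoord z i))"
  by (simp add: l1norm_def sum_UNIV_Plus sum.distrib zcoord_def)

lemma mdeg_add [simp]: "mdeg (k + l) = mdeg k + mdeg l"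
  by (simp add: mdeg_eq_sum_expo sum.distrib)

lemma mdeg_0 [simp]: "mdeg 0 = 0"
  by (simp add: mdeg_eq_sum_expo)

lemma mdeg_munit [simp]: "mdeg (munit i) = 1"
  by (simp add: mdeg_eq_sum_expo)

lemma mdeg_eq_0_iff [simp]: "mdeg k = 0 \<longleftrightarrow> k = 0"
  by (simp add: mdeg_eq_sum_expo expo_eq_iff)

lemma expo_le_mdeg: "expo k i \<le> mdeg k"
  unfolding mdeg_eq_sum_expo by (rule member_le_sum) auto

lemma expo_pos_decompose:
  assumes "expo k i > 0"
  obtains l where "k = l + munit i"
proof (cases i)
  case (Inl j)
  have "k = ((\<chi> j'. fst k $ j' - axis j 1 $ j'), snd k) + munit i"
    using assms Inl by (auto simp: prod_eq_iff vec_eq_iff munit_def axis_def)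
  then show thesis by (rule that)
next
  case (Inr j)
  have "k = (fst k, (\<chi> j'. snd k $ j' - axis j 1 $ j')) + munit i"
    using assms Inr by (auto simp: prod_eq_iff vec_eq_iff munit_def axis_def)
  then show thesis by (rule that)
qed

text \<open>Every index of degree m is a summand of the constant index (m, ..., m), and an index has
  only finitely many splittings.\<close>

lemma finite_mdeg_eq [simp]: "finite {k :: 'n::finite mindex. mdeg k = m}"
proof -
  let ?K = "((\<chi> j. m), (\<chi> j. m)) :: 'n mindex"
  have "{k :: 'n mindex. mdeg k = m} \<subseteq> fst ` {(l, l'). l + l' = ?K}"
  proof
    fix k :: "'n mindex" assume "k \<in> {k. mdeg k = m}"
    then have "expo k i \<le> m" for i using expo_le_mdeg[of k i] by simp
    then have "fst k $ j \<le> m" "snd k $ j \<le> m" for j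
      using expo_simps[of k j] by metis+
    then have "k + ((\<chi> j. m - fst k $ j), (\<chi> j. m - snd k $ j)) = ?K"
      by (auto simp: prod_eq_iff vec_eq_iff)
    then show "k \<in> fst ` {(l, l'). l + l' = ?K}"
      by (intro image_eqI[of _ _ "(k, ((\<chi> j. m - fst k $ j), (\<chi> j. m - snd k $ j)))"]) auto
  qed
  then show ?thesis by (rule finite_subset) (intro finite_imageI finite_mindex_splits)
qed

section \<open>Multinomial coefficients and their convolution\<close>

definition splits :: "'n::finite mindex \<Rightarrow> ('n mindex \<times> 'n mindex) set" where
  "splits k = {(l, m). l + m = k}"

lemma finite_splits [simp]: "finite (splits k)"
  unfolding splits_def by (rule finite_mindex_splits)

text \<open>The coefficients of the exponential of s, the sum of all variables. Every partial
  derivative fixes this series, which is the content of \<open>ifact_add_munit\<close>.\<close>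

definition ifact :: "'n::finite mindex \<Rightarrow> real" where
  "ifact k = 1 / (\<Prod>i\<in>UNIV. fact (expo k i))"

lemma ifact_pos: "ifact k > 0"
  by (simp add: ifact_def prod_pos)

lemma ifact_0 [simp]: "ifact 0 = 1"
  by (simp add: ifact_def)

lemma ifact_add_munit: "real (expo k i + 1) * ifact (k + munit i) = ifact k"
proof -
  have "(\<Prod>i'\<in>UNIV. fact (expo (k + munit i) i') :: real)
      = (\<Prod>i'\<in>UNIV. (if i = i' then real (expo k i + 1) else 1) * fact (expo k i'))"
    by (rule prod.cong) (auto simp: algebra_simps)
  also have "\<dots> = real (expo k i + 1) * (\<Prod>i'\<in>UNIV. fact (expo k i'))"
    by (simp add: prod.distrib)
  finally show ?thesis by (simp add: ifact_def)
qed

text \<open>The coefficient of the monomial k in the power of s with exponent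
  \<open>mdeg k\<close>.\<close>

definition multinom :: "'n::finite mindex \<Rightarrow> real" where
  "multinom k = fact (mdeg k) * ifact k"

lemma multinom_nonneg: "multinom k \<ge> 0"
  by (simp add: multinom_def less_imp_le[OF ifact_pos])

lemma multinom_add_munit:
  "real (expo k i + 1) * multinom (k + munit i) = real (mdeg k + 1) * multinom k"
  using ifact_add_munit[of k i] by (simp add: multinom_def algebra_simps)

text \<open>Adding \<open>munit i\<close> is a bijection from degree m onto the indices of degree
  \<open>Suc m\<close> with positive i-th exponent; all other indices carry the factor 0.\<close>

lemma sum_expo_mdeg_Suc:
  fixes F :: "'n::finite mindex \<Rightarrow> real"
  shows "(\<Sum>k | mdeg k = Suc m. real (expo k i) * F k)
    = (\<Sum>k | mdeg k = m. real (expo k i + 1) * F (k + munit i))"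
proof -
  have inj: "inj_on (\<lambda>k. k + munit i) {k :: 'n mindex. mdeg k = m}"
    by (auto simp: inj_on_def)
  have img: "(\<lambda>k. k + munit i) ` {k :: 'n mindex. mdeg k = m} = {k. mdeg k = Suc m \<and> expo k i > 0}"
    by (auto elim!: expo_pos_decompose)
  have "(\<Sum>k | mdeg k = Suc m. real (expo k i) * F k)
      = (\<Sum>k | mdeg k = Suc m \<and> expo k i > 0. real (expo k i) * F k)"
    by (rule sum.mono_neutral_right) auto
  also have "\<dots> = (\<Sum>k | mdeg k = m. real (expo (k + munit i) i) * F (k + munit i))"
    unfolding img[symmetric] by (subst sum.reindex[OF inj]) simp
  finally show ?thesis by simp
qed

text \<open>The multinomial theorem through Euler's relation: the factor \<open>Suc m\<close> is
  written as the sum of the exponents, and each exponent serves to strip one variable.\<close>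

lemma sum_ifact_power:
  fixes x :: "'n::finite + 'n \<Rightarrow> real"
  shows "(\<Sum>k | mdeg k = m. ifact k * (\<Prod>i\<in>UNIV. x i ^ expo k i)) = (\<Sum>i\<in>UNIV. x i) ^ m / fact m"
proof (induction m)
  case 0
  then show ?case by simp
next
  case (Suc m)
  let ?P = "\<lambda>k. \<Prod>i\<in>UNIV. x i ^ expo k i"
  have P: "?P (k + munit i) = x i * ?P k" for k i
  proof -
    have "?P (k + munit i) = (\<Prod>i'\<in>UNIV. (if i = i' then x i else 1) * x i' ^ expo k i')"
      by (rule prod.cong) auto
    then show ?thesis by (simp add: prod.distrib)
  qed
  have "real (Suc m) * (\<Sum>k | mdeg k = Suc m. ifact k * ?P k)
      = (\<Sum>k | mdeg k = Suc m. (\<Sum>i\<in>UNIV. real (expo k i) * (ifact k * ?P k)))"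
    unfolding sum_distrib_left
    by (rule sum.cong) (auto simp: mdeg_eq_sum_expo simp flip: sum_distrib_right of_nat_sum)
  also have "\<dots> = (\<Sum>i\<in>UNIV. \<Sum>k | mdeg k = Suc m. real (expo k i) * (ifact k * ?P k))"
    by (rule sum.swap)
  also have "\<dots> = (\<Sum>i\<in>UNIV. \<Sum>k | mdeg k = m. x i * (ifact k * ?P k))"
    unfolding sum_expo_mdeg_Suc P
    by (intro sum.cong refl) (subst ifact_add_munit[symmetric], simp only: ac_simps)
  also have "\<dots> = (\<Sum>i\<in>UNIV. x i) * ((\<Sum>i\<in>UNIV. x i) ^ m / fact m)"
    by (simp only: sum_distrib_left[symmetric] Suc.IH sum_distrib_right)
  finally show ?case
    by (simp add: eq_divide_eq mult.commute mult.left_commute del: of_nat_Suc)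
qed

lemma sum_multinom_power:
  fixes x :: "'n::finite + 'n \<Rightarrow> real"
  shows "(\<Sum>k | mdeg k = m. multinom k * (\<Prod>i\<in>UNIV. x i ^ expo k i)) = (\<Sum>i\<in>UNIV. x i) ^ m"
proof -
  have "(\<Sum>k | mdeg k = m. multinom k * (\<Prod>i\<in>UNIV. x i ^ expo k i))
      = fact m * (\<Sum>k | mdeg k = m. ifact k * (\<Prod>i\<in>UNIV. x i ^ expo k i))"
    unfolding sum_distrib_left by (rule sum.cong) (auto simp: multinom_def)
  then show ?thesis by (simp add: sum_ifact_power)
qed

text \<open>Compares coefficients in (s^p / p!) (s^q / q!) = binom(p+q, p) s^(p+q) / (p+q)!. In the
  induction the factor \<open>Suc p\<close> is spread over the exponents of l, each of which removes
  the same unit from l and from k.\<close>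

lemma ifact_vandermonde:
  fixes k :: "'n::finite mindex"
  assumes "p \<le> mdeg k"
  shows "(\<Sum>(l, m)\<in>{(l, m)\<in>splits k. mdeg l = p}. ifact l * ifact m)
    = real (mdeg k choose p) * ifact k"
  using assms
proof (induction p arbitrary: k)
  case 0
  have "{(l, m)\<in>splits k. mdeg l = 0} = {(0, k)}"
    by (auto simp: splits_def)
  then show ?case by simp
next
  case (Suc p)
  let ?S = "\<lambda>q k :: 'n mindex. {(l, m)\<in>splits k. mdeg l = q}"
  have fin: "finite (?S q k)" for q k
    by (rule finite_subset[OF _ finite_splits[of k]]) auto
  have step: "(\<Sum>(l, m)\<in>?S (Suc p) k. real (expo l i) * (ifact l * ifact m))
      = real (expo k i) * real ((mdeg k - 1) choose p) * ifact k" for i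
  proof (cases "expo k i = 0")
    case True
    then have "(\<Sum>(l, m)\<in>?S (Suc p) k. real (expo l i) * (ifact l * ifact m)) = 0"
      by (intro sum.neutral) (auto simp: splits_def)
    then show ?thesis using True by simp
  next
    case False
    then obtain k0 where k0: "k = k0 + munit i" using expo_pos_decompose by blast
    have p: "p \<le> mdeg k0" using Suc.prems k0 by simp
    let ?f = "\<lambda>(l, m). (l + munit i, m)"
    have inj: "inj_on ?f (?S p k0)" by (auto simp: inj_on_def)
    have img: "?f ` ?S p k0 = {(l, m)\<in>?S (Suc p) k. expo l i > 0}"
    proof (intro equalityI subsetI)
      fix q assume "q \<in> {(l, m)\<in>?S (Suc p) k. expo l i > 0}"
      then obtain l m where q: "q = (l, m)" "l + m = k" "mdeg l = Suc p" "expo l i > 0"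
        by (auto simp: splits_def)
      then obtain l0 where l0: "l = l0 + munit i" using expo_pos_decompose by blast
      have "l0 + m = k0" using q(2) unfolding l0 k0 by (simp add: add.assoc add.commute[of "munit i"])
          (metis add.assoc add_right_cancel)
      then show "q \<in> ?f ` ?S p k0"
        using q l0 by (intro image_eqI[of _ _ "(l0, m)"]) (auto simp: splits_def)
    qed (auto simp: splits_def k0 ac_simps)
    have "(\<Sum>(l, m)\<in>?S (Suc p) k. real (expo l i) * (ifact l * ifact m))
        = (\<Sum>(l, m)\<in>{(l, m)\<in>?S (Suc p) k. expo l i > 0}. real (expo l i) * (ifact l * ifact m))"
      by (rule sum.mono_neutral_right[OF fin]) auto
    also have "\<dots> = (\<Sum>(l, m)\<in>?S p k0. real (expo l i + 1) * ifact (l + munit i) * ifact m)"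
      unfolding img[symmetric] by (subst sum.reindex[OF inj]) (simp add: case_prod_unfold mult.assoc)
    also have "\<dots> = real (mdeg k0 choose p) * ifact k0"
      unfolding ifact_add_munit using Suc.IH[OF p] by simp
    also have "\<dots> = real (mdeg k0 choose p) * (real (expo k i) * ifact k)"
      using ifact_add_munit[of k0 i] by (simp add: k0)
    finally show ?thesis by (simp add: k0)
  qed
  have "real (Suc p) * (\<Sum>(l, m)\<in>?S (Suc p) k. ifact l * ifact m)
      = (\<Sum>(l, m)\<in>?S (Suc p) k. \<Sum>i\<in>UNIV. real (expo l i) * (ifact l * ifact m))"
    unfolding sum_distrib_left
    by (rule sum.cong) (auto simp: mdeg_eq_sum_expo simp flip: sum_distrib_right of_nat_sum)
  also have "\<dots> = (\<Sum>i\<in>UNIV. \<Sum>(l, m)\<in>?S (Suc p) k. real (expo l i) * (ifact l * ifact m))"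
    unfolding case_prod_unfold by (rule sum.swap)
  also have "\<dots> = real (mdeg k) * real ((mdeg k - 1) choose p) * ifact k"
    unfolding step by (simp add: mdeg_eq_sum_expo flip: sum_distrib_right)
  also have "\<dots> = real (Suc p) * (real (mdeg k choose Suc p) * ifact k)"
  proof -
    obtain K where K: "mdeg k = Suc K" using Suc.prems by (cases "mdeg k") auto
    have "real (mdeg k) * real ((mdeg k - 1) choose p) = real (Suc p) * real (mdeg k choose Suc p)"
      using arg_cong[OF Suc_times_binomial[of p K], of real] unfolding K of_nat_mult diff_Suc_1 by simp
    then show ?thesis by (simp add: mult.assoc)
  qed
  finally show ?case by simp
qed

text \<open>The coefficient form of s^p s^q = s^(p+q).\<close>

lemma multinom_vandermonde:
  assumes "p \<le> mdeg k"
  shows "(\<Sum>(l, m)\<in>{(l, m)\<in>splits k. mdeg l = p}. multinom l * multinom m) = multinom k"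
proof -
  have "(\<Sum>(l, m)\<in>{(l, m)\<in>splits k. mdeg l = p}. multinom l * multinom m)
      = fact p * fact (mdeg k - p) * (\<Sum>(l, m)\<in>{(l, m)\<in>splits k. mdeg l = p}. ifact l * ifact m)"
    unfolding sum_distrib_left by (rule sum.cong) (auto simp: multinom_def splits_def)
  also have "\<dots> = fact p * fact (mdeg k - p) * real (mdeg k choose p) * ifact k"
    by (simp add: ifact_vandermonde[OF assms])
  also have "fact p * fact (mdeg k - p) * real (mdeg k choose p) = fact (mdeg k)"
    using binomial_fact_lemma[OF assms] by (metis of_nat_fact of_nat_mult)
  finally show ?thesis by (simp add: multinom_def)
qed

text \<open>Series in s alone multiply like series in one variable: grouping the splittings by
  \<open>mdeg l\<close> leaves a convolution over degrees.\<close>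

lemma sum_splits_multinom:
  fixes \<phi> :: "nat \<Rightarrow> nat \<Rightarrow> real"
  shows "(\<Sum>(l, m)\<in>splits k. \<phi> (mdeg l) (mdeg m) * (multinom l * multinom m))
    = (\<Sum>p\<le>mdeg k. \<phi> p (mdeg k - p)) * multinom k"
proof -
  let ?g = "\<lambda>(l, m). \<phi> (mdeg l) (mdeg m) * (multinom l * multinom m)"
  have "(\<Sum>q\<in>splits k. ?g q) = (\<Sum>p\<le>mdeg k. \<Sum>q\<in>{q\<in>splits k. mdeg (fst q) = p}. ?g q)"
    by (rule sum.group[symmetric]) (simp, simp, auto simp: splits_def)
  also have "\<dots> = (\<Sum>p\<le>mdeg k. \<phi> p (mdeg k - p) * multinom k)"
  proof (rule sum.cong[OF refl])
    fix p assume "p \<in> {..mdeg k}"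
    then have p: "p \<le> mdeg k" by simp
    have "(\<Sum>q\<in>{q\<in>splits k. mdeg (fst q) = p}. ?g q)
        = (\<Sum>(l, m)\<in>{(l, m)\<in>splits k. mdeg l = p}. \<phi> p (mdeg k - p) * (multinom l * multinom m))"
      by (rule sum.cong) (auto simp: splits_def)
    then show "(\<Sum>q\<in>{q\<in>splits k. mdeg (fst q) = p}. ?g q) = \<phi> p (mdeg k - p) * multinom k"
      using multinom_vandermonde[OF p] by (simp add: case_prod_unfold flip: sum_distrib_left)
  qed
  finally show ?thesis by (simp add: sum_distrib_right)
qed

text \<open>Stripping one unit multiplies by a quotient of an exponent and the degree, and an
  exponent never exceeds the degree.\<close>

lemma multinom_ge_1: "multinom k \<ge> 1"
proof (induction "mdeg k" arbitrary: k)
  case 0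
  then show ?case by (simp add: multinom_def)
next
  case (Suc m)
  then obtain i where "expo k i > 0" by (metis expo_0 expo_eq_iff gr0I mdeg_0 nat.simps(3))
  then obtain l where l: "k = l + munit i" using expo_pos_decompose by blast
  have "1 * real (expo l i + 1) \<le> multinom l * real (mdeg l + 1)"
    using Suc l expo_le_mdeg[of l i] by (intro mult_mono) (auto simp: multinom_nonneg)
  also have "\<dots> = multinom k * real (expo l i + 1)"
    using multinom_add_munit[of l i] by (simp add: l mult.commute)
  finally show ?case by (rule mult_right_le_imp_le) simp
qed

section \<open>The rescaled equation\<close>

lemma fs_mult_eq: "fs_mult F G k = (\<Sum>(l, m)\<in>splits k. F l * G m)"
  by (simp add: fs_mult_def splits_def)

lemma dz_eq: "dz j F k = of_nat (expo k (Inl j) + 1) * F (k + munit (Inl j))"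
  by (simp add: dz_def munit_def)

lemma dzbar_eq: "dzbar j F k = of_nat (expo k (Inr j) + 1) * F (k + munit (Inr j))"
  by (simp add: dzbar_def munit_def)

text \<open>The i-th derivative times c times the i-th variable is an Euler operator, diagonal on
  monomials. Both products in the bracket with \<open>H2\<close> have this shape.\<close>

lemma fs_mult_deriv_single:
  assumes F: "\<And>l. F l = of_nat (expo l i + 1) * G (l + munit i)"
    and S: "\<And>m. S m = (if m = munit i then c else 0)"
  shows "fs_mult F S k = of_nat (expo k i) * G k * c"
proof (cases "expo k i = 0")
  case True
  have "fs_mult F S k = 0"
    unfolding fs_mult_eq
  proof (rule sum.neutral, clarify)
    fix l m :: "'a mindex" assume "(l, m) \<in> splits k"
    then have "expo k i = expo l i + expo m i" by (auto simp: splits_def)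
    then have "m \<noteq> munit i" using True by auto
    then show "F l * S m = 0" by (simp add: S)
  qed
  then show ?thesis using True by simp
next
  case False
  then obtain k0 where k0: "k = k0 + munit i" using expo_pos_decompose by blast
  have "fs_mult F S k = (\<Sum>(l, m)\<in>{(k0, munit i)}. F l * S m)"
    unfolding fs_mult_eq
  proof (rule sum.mono_neutral_right)
    show "\<forall>q\<in>splits k - {(k0, munit i)}. (case q of (l, m) \<Rightarrow> F l * S m) = 0"
    proof
      fix q assume q: "q \<in> splits k - {(k0, munit i)}"
      then have "fst q + snd q = k0 + munit i" by (auto simp: splits_def k0)
      then have "snd q \<noteq> munit i" using q by (metis DiffE add_right_cancel prod.collapse singletonI)
      then show "(case q of (l, m) \<Rightarrow> F l * S m) = 0" by (simp add: case_prod_unfold S)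
    qed
  qed (simp_all add: splits_def k0 finite_mindex_splits)
  then show ?thesis by (simp add: F S k0)
qed

section \<open>The bracket with the quadratic part and the integrating factor\<close>

lemma dz_H2: "dz j (H2 \<omega>) k = (if k = munit (Inr j) then of_real (\<omega> $ j) else 0)"
proof -
  have iff: "k + munit (Inl j) = (axis i 1, axis i 1) \<longleftrightarrow> i = j \<and> k = munit (Inr j)" for i
  proof
    assume *: "k + munit (Inl j) = (axis i 1, axis i 1)"
    then have "fst k + axis j 1 = axis i 1" by (simp add: prod_eq_iff munit_def)
    then have "(fst k + axis j 1) $ j = axis i 1 $ j" by simp
    then have "i = j" by (simp add: axis_def split: if_splits)
    moreover from this * have "k = munit (Inr j)"
      by (auto simp: munit_def prod_eq_iff)
    ultimately show "i = j \<and> k = munit (Inr j)" by simp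
  qed (simp add: munit_def add_Pair)
  show ?thesis
    unfolding dz_eq H2_def iff by (cases "k = munit (Inr j)") (simp_all add: munit_def)
qed

lemma dzbar_H2: "dzbar j (H2 \<omega>) k = (if k = munit (Inl j) then of_real (\<omega> $ j) else 0)"
proof -
  have iff: "k + munit (Inr j) = (axis i 1, axis i 1) \<longleftrightarrow> i = j \<and> k = munit (Inl j)" for i
  proof
    assume *: "k + munit (Inr j) = (axis i 1, axis i 1)"
    then have "snd k + axis j 1 = axis i 1" by (simp add: prod_eq_iff munit_def)
    then have "(snd k + axis j 1) $ j = axis i 1 $ j" by simp
    then have "i = j" by (simp add: axis_def split: if_splits)
    moreover from this * have "k = munit (Inl j)"
      by (auto simp: munit_def prod_eq_iff)
    ultimately show "i = j \<and> k = munit (Inl j)" by simp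
  qed (simp add: munit_def add_Pair)
  show ?thesis
    unfolding dzbar_eq H2_def iff by (cases "k = munit (Inl j)") (simp_all add: munit_def)
qed

lemma pairing_mdiff_add:
  "pairing \<omega> (mdiff (k + l)) = pairing \<omega> (mdiff k) + pairing \<omega> (mdiff l)"
  by (simp add: pairing_def mdiff_def algebra_simps sum.distrib sum_subtractf)

lemma pairing_mdiff_munit:
  "pairing \<omega> (mdiff (munit (Inl j))) = - \<omega> $ j"
  "pairing \<omega> (mdiff (munit (Inr j))) = \<omega> $ j"
proof -
  have "(\<Sum>i\<in>UNIV. \<omega> $ i * real (axis j 1 $ i)) = \<omega> $ j"
    by (subst sum.remove[of _ j]) (auto simp: axis_def intro!: sum.neutral)
  then show "pairing \<omega> (mdiff (munit (Inl j))) = - \<omega> $ j"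
    "pairing \<omega> (mdiff (munit (Inr j))) = \<omega> $ j"
    by (simp_all add: pairing_def mdiff_def munit_def sum_negf)
qed

text \<open>The two Euler operators of each conjugate pair enter with opposite signs, so the
  eigenvalue is built from differences of exponents.\<close>

lemma poisson_H2: "poisson F (H2 \<omega>) k = \<i> * of_real (pairing \<omega> (mdiff k)) * F k"
proof -
  have 1: "fs_mult (dzbar j F) (dz j (H2 \<omega>)) k = of_nat (expo k (Inr j)) * F k * of_real (\<omega> $ j)" for j
    by (rule fs_mult_deriv_single[OF dzbar_eq dz_H2])
  have 2: "fs_mult (dz j F) (dzbar j (H2 \<omega>)) k = of_nat (expo k (Inl j)) * F k * of_real (\<omega> $ j)" for j
    by (rule fs_mult_deriv_single[OF dz_eq dzbar_H2])
  have "poisson F (H2 \<omega>) k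
      = \<i> * (\<Sum>j\<in>UNIV. of_real (\<omega> $ j * of_int (mdiff k $ j)) * F k)"
    unfolding poisson_def by (simp add: 1 2 mdiff_def algebra_simps)
  then show ?thesis
    by (simp only: pairing_def of_real_sum sum_distrib_right mult.assoc)
qed

lemma poisson_fs_add_right: "poisson F (fs_add G K) k = poisson F G k + poisson F K k"
proof -
  have "dz j (fs_add G K) = fs_add (dz j G) (dz j K)"
    "dzbar j (fs_add G K) = fs_add (dzbar j G) (dzbar j K)" for j
    by (simp_all add: fun_eq_iff dz_def dzbar_def fs_add_def algebra_simps)
  moreover have "fs_mult A (fs_add B C) k = fs_mult A B k + fs_mult A C k" for A B C :: "'a fseries"
    by (simp add: fs_mult_eq fs_add_def case_prod_unfold algebra_simps sum.distrib)
  ultimately show ?thesis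
    by (simp add: poisson_def algebra_simps sum.distrib sum_subtractf)
qed

lemma flow_solution_low:
  "flow_solution \<omega> Hhat H \<Longrightarrow> mdeg k \<le> 2 \<Longrightarrow> H \<delta> k = 0"
  unfolding flow_solution_def F_diamond_def by blast

text \<open>The quadratic part contributes a decay at rate \<open>freq\<close>, since p times sgn p
  is the absolute value of p. The exponential is the integrating factor that cancels it, so only the
  bracket with H itself remains.\<close>

lemma rescaled_has_vector_derivative:
  assumes "flow_solution \<omega> Hhat H"
  shows "((\<lambda>s. rescaled \<omega> H s k) has_vector_derivative
    - poisson (xi \<omega> (H \<delta>)) (H \<delta>) k * of_real (exp (freq \<omega> (mdiff k) * \<delta>))) (at \<delta>)"
proof -
  let ?f = "freq \<omega> (mdiff k)"
  let ?p = "pairing \<omega> (mdiff k)"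
  \<comment> \<open>Below degree 3 both sides vanish, so the case distinction in \<open>xi\<close>
    disappears.\<close>
  have "xi \<omega> (H \<delta>) k = - \<i> * of_real (sgn ?p) * H \<delta> k"
    using flow_solution_low[OF assms] by (simp add: xi_def sigma_def)
  then have "poisson (xi \<omega> (H \<delta>)) (H2 \<omega>) k = (\<i> * - \<i>) * of_real (?p * sgn ?p) * H \<delta> k"
    unfolding poisson_H2 of_real_mult by (simp only: mult_ac)
  then have H2: "poisson (xi \<omega> (H \<delta>)) (H2 \<omega>) k = of_real ?f * H \<delta> k"
    by (simp add: freq_def abs_sgn)
  have "((\<lambda>s. H s k) has_vector_derivative
      - (of_real ?f * H \<delta> k + poisson (xi \<omega> (H \<delta>)) (H \<delta>) k)) (at \<delta>)"
    unfolding H2[symmetric] poisson_fs_add_right[symmetric]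
    using assms unfolding flow_solution_def by blast
  moreover have "((\<lambda>s. complex_of_real (exp (?f * s))) has_vector_derivative
      of_real (?f * exp (?f * \<delta>))) (at \<delta>)"
    by (rule has_vector_derivative_of_real) (auto intro!: derivative_eq_intros)
  ultimately have "((\<lambda>s. H s k * of_real (exp (?f * s))) has_vector_derivative
      H \<delta> k * of_real (?f * exp (?f * \<delta>))
      + - (of_real ?f * H \<delta> k + poisson (xi \<omega> (H \<delta>)) (H \<delta>) k) * of_real (exp (?f * \<delta>))) (at \<delta>)"
    by (rule has_vector_derivative_mult)
  then show ?thesis
    by (simp add: rescaled_def algebra_simps)
qed

section \<open>Estimates of the nonlinear bracket\<close>

lemma norm_poisson_le:
  "norm (poisson F G k) \<le> (\<Sum>j\<in>UNIV. \<Sum>(l, m)\<in>splits k.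
     norm (dzbar j F l) * norm (dz j G m) + norm (dz j F l) * norm (dzbar j G m))"
proof -
  have "norm (fs_mult A B k - fs_mult C D k)
      \<le> (\<Sum>(l, m)\<in>splits k. norm (A l) * norm (B m) + norm (C l) * norm (D m))" for A B C D :: "'a fseries"
    unfolding fs_mult_eq sum_subtractf[symmetric] case_prod_unfold norm_mult[symmetric]
    by (intro sum_norm_le norm_triangle_ineq4)
  then show ?thesis
    unfolding poisson_def norm_mult by (simp add: sum_norm_le)
qed

text \<open>Bounds in degrees below \<open>mdeg k\<close> suffice because G starts in degree 3,
  which makes an induction on the degree possible. The factor 2 n counts the two products in the
  bracket for each of the n conjugate pairs.\<close>

lemma norm_poisson_majorant:
  fixes F G :: "'n::finite fseries"
  assumes "\<delta> \<ge> 0"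
    and FG: "\<And>l. norm (F l) \<le> norm (G l)"
    and low: "\<And>l. mdeg l \<le> 2 \<Longrightarrow> G l = 0"
    and b: "\<And>p. b p \<ge> 0"
    and le: "\<And>l. mdeg l < mdeg k \<Longrightarrow>
      norm (G l) * exp (freq \<omega> (mdiff l) * \<delta>) \<le> b (mdeg l) * multinom l"
  shows "norm (poisson F G k) * exp (freq \<omega> (mdiff k) * \<delta>)
    \<le> 2 * real CARD('n) * (\<Sum>p\<le>mdeg k. (real (p + 1) * b (p + 1))
        * (real (mdeg k - p + 1) * b (mdeg k - p + 1))) * multinom k"
proof -
  let ?E = "\<lambda>l. exp (freq \<omega> (mdiff l) * \<delta>)"
  let ?R = "\<lambda>l. norm (G l) * ?E l"
  let ?c = "\<lambda>l i. real (expo l i + 1)"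
  let ?b = "\<lambda>p. real (p + 1) * b (p + 1)"
  have summand: "?c l i * norm (F (l + munit i)) * (?c m i' * norm (G (m + munit i'))) * ?E k
      \<le> ?b (mdeg l) * ?b (mdeg m) * (multinom l * multinom m)"
    if lm: "(l, m) \<in> splits k"
      and ii': "pairing \<omega> (mdiff (munit i)) + pairing \<omega> (mdiff (munit i')) = 0" for l m i i'
  \<comment> \<open>If l or m has degree at most 1, a differentiated factor has degree at most 2 and
    vanishes. Otherwise both degrees are at least 2, so \<open>l + munit i\<close> and
    \<open>m + munit i'\<close> have degree below \<open>mdeg k\<close>.\<close>
  proof (cases "mdeg l \<le> 1 \<or> mdeg m \<le> 1")
    case True
    then have "norm (F (l + munit i)) = 0 \<or> norm (G (m + munit i')) = 0"
      using low[of "l + munit i"] low[of "m + munit i'"] FG[of "l + munit i"] by auto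
    then have "?c l i * norm (F (l + munit i)) * (?c m i' * norm (G (m + munit i'))) * ?E k = 0"
      by (elim disjE) simp_all
    then show ?thesis
      using b multinom_nonneg by (metis mult_nonneg_nonneg of_nat_0_le_iff)
  next
    case False
    have k: "k = l + m" using lm by (simp add: splits_def)
    have R: "?c l i * ?R (l + munit i) \<le> ?b (mdeg l) * multinom l"
      if "mdeg l + 1 < mdeg k" for l :: "'n mindex" and i
    proof -
      have "?c l i * ?R (l + munit i) \<le> ?c l i * (b (mdeg l + 1) * multinom (l + munit i))"
        using le[of "l + munit i"] that by (intro mult_left_mono) auto
      also have "\<dots> = b (mdeg l + 1) * (?c l i * multinom (l + munit i))" by simp
      also have "\<dots> = ?b (mdeg l) * multinom l" unfolding multinom_add_munit by simp
      finally show ?thesis .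
    qed
    \<comment> \<open>The two units form a conjugate pair, so their pairings with \<omega> cancel
      and the triangle inequality applies.\<close>
    have "freq \<omega> (mdiff k) \<le> freq \<omega> (mdiff (l + munit i)) + freq \<omega> (mdiff (m + munit i'))"
      using ii' by (simp add: freq_def pairing_mdiff_add k)
    then have "freq \<omega> (mdiff k) * \<delta> \<le> (freq \<omega> (mdiff (l + munit i)) + freq \<omega> (mdiff (m + munit i'))) * \<delta>"
      using \<open>\<delta> \<ge> 0\<close> by (rule mult_right_mono)
    then have E: "?E k \<le> ?E (l + munit i) * ?E (m + munit i')"
      by (simp add: algebra_simps flip: exp_add)
    have "?c l i * norm (F (l + munit i)) * (?c m i' * norm (G (m + munit i'))) * ?E k
        \<le> ?c l i * norm (G (l + munit i)) * (?c m i' * norm (G (m + munit i')))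
          * (?E (l + munit i) * ?E (m + munit i'))"
      using E FG by (intro mult_mono) auto
    also have "\<dots> = (?c l i * ?R (l + munit i)) * (?c m i' * ?R (m + munit i'))"
      by (simp add: ac_simps)
    also have "\<dots> \<le> (?b (mdeg l) * multinom l) * (?b (mdeg m) * multinom m)"
      using False k by (intro mult_mono R) (auto simp: b multinom_nonneg)
    finally show ?thesis by (simp add: ac_simps)
  qed
  have "norm (poisson F G k) * ?E k \<le> (\<Sum>j\<in>UNIV. \<Sum>(l, m)\<in>splits k.
     (norm (dzbar j F l) * norm (dz j G m)) * ?E k + (norm (dz j F l) * norm (dzbar j G m)) * ?E k)"
    using mult_right_mono[OF norm_poisson_le[of F G k], of "?E k"]
    by (simp only: sum_distrib_right case_prod_unfold distrib_right exp_ge_zero simp_thms True_implies_equals)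
  also have "\<dots> \<le> (\<Sum>j\<in>(UNIV :: 'n set). \<Sum>(l, m)\<in>splits k.
      2 * (?b (mdeg l) * ?b (mdeg m) * (multinom l * multinom m)))"
  proof (intro sum_mono, clarify)
    fix j :: 'n and l m :: "'n mindex" assume lm: "(l, m) \<in> splits k"
    show "(norm (dzbar j F l) * norm (dz j G m)) * ?E k + (norm (dz j F l) * norm (dzbar j G m)) * ?E k
        \<le> 2 * (?b (mdeg l) * ?b (mdeg m) * (multinom l * multinom m))"
      using summand[OF lm, of "Inr j" "Inl j"] summand[OF lm, of "Inl j" "Inr j"]
      unfolding dz_eq dzbar_eq norm_mult norm_of_nat pairing_mdiff_munit by linarith
  qed
  also have "\<dots> = 2 * real CARD('n) * (\<Sum>(l, m)\<in>splits k. ?b (mdeg l) * ?b (mdeg m) * (multinom l * multinom m))"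
    unfolding case_prod_unfold sum_distrib_left[symmetric] sum_constant by simp
  finally show ?thesis
    unfolding sum_splits_multinom[of "\<lambda>p q. ?b p * ?b q"] unfolding mult.assoc .
qed

section \<open>The one-variable majorant\<close>

fun catd :: "nat \<Rightarrow> real" where
  "catd 0 = 4"
| "catd (Suc j) = (\<Sum>i\<le>j. catd i * catd (j - i)) / 4"

lemma catd_pos: "catd j > 0"
proof (induction j rule: less_induct)
  case (less j)
  show ?case
  proof (cases j)
    case (Suc i)
    then show ?thesis using less by (auto intro!: sum_pos mult_pos_pos)
  qed simp
qed

text \<open>The two end terms of the convolution already double the value. The bound compensates the
  divisor m in \<open>majorant\<close> at time 0; it is attained at index 1, where the start value 4
  gives 4.\<close>

lemma catd_ge: "catd j \<ge> real j + 3"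
proof (induction j)
  case (Suc j)
  show ?case
  proof (cases j)
    case (Suc i)
    have "(\<Sum>i\<in>{0, j}. catd i * catd (j - i)) \<le> (\<Sum>i\<le>j. catd i * catd (j - i))"
      by (rule sum_mono2) (auto intro: mult_nonneg_nonneg less_imp_le[OF catd_pos])
    then have "2 * catd j \<le> catd (Suc j)" using Suc by simp
    then show ?thesis using Suc.IH by simp
  qed simp
qed simp

text \<open>For the summands the recursion has the factor 1/16, so each partial sum is at most 4 +
  S^2 / 16 with S the preceding one. The number 8 is the fixed point of this map.\<close>

lemma sum_catd_le: "(\<Sum>j\<le>N. catd j / 4 ^ j) \<le> 8"
proof (induction N)
  case (Suc N)
  let ?x = "\<lambda>j. catd j / 4 ^ j"
  have pos: "?x j \<ge> 0" for j using catd_pos[of j] by simp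
  have "(\<Sum>j\<le>Suc N. ?x j) = 4 + (\<Sum>j\<le>N. ?x (Suc j))"
    by (subst sum.atMost_Suc_shift) simp
  also have "(\<Sum>j\<le>N. ?x (Suc j)) = (\<Sum>j\<le>N. \<Sum>i\<le>j. ?x i * ?x (j - i)) / 16"
    unfolding sum_divide_distrib
    by (intro sum.cong refl) (auto simp: sum_divide_distrib field_simps intro!: sum.cong simp flip: power_add)
  also have "(\<Sum>j\<le>N. \<Sum>i\<le>j. ?x i * ?x (j - i)) = (\<Sum>(i, j)\<in>{(i, j). i + j \<le> N}. ?x i * ?x j)"
    by (rule sum.triangle_reindex_eq[symmetric])
  \<comment> \<open>Enlarging the triangle to the square turns the convolution into the square of
    the partial sum.\<close>
  also have "\<dots> \<le> (\<Sum>(i, j)\<in>{..N} \<times> {..N}. ?x i * ?x j)"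
    by (rule sum_mono2) (auto simp: less_imp_le[OF catd_pos])
  also have "\<dots> = (\<Sum>j\<le>N. ?x j) * (\<Sum>j\<le>N. ?x j)"
    by (simp add: sum_product sum.cartesian_product)
  also have "\<dots> \<le> 8 * 8"
    using Suc.IH by (intro mult_mono) (auto intro!: sum_nonneg pos)
  finally show ?case by simp
qed simp

text \<open>The coefficients of f as a series in s, with t standing for T/\<rho>. The divisor m
  makes the coefficients of f'(s) plain products of h, \<open>catd\<close> and a power of t.\<close>

definition majorant :: "real \<Rightarrow> real \<Rightarrow> nat \<Rightarrow> real" where
  "majorant h t m = (if m < 3 then 0 else h * catd (m - 3) / real m * t ^ (m - 3))"

lemma majorant_nonneg: "h \<ge> 0 \<Longrightarrow> t \<ge> 0 \<Longrightarrow> majorant h t m \<ge> 0"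
  using catd_pos[of "m - 3"] by (simp add: majorant_def)

text \<open>These are the coefficients of f'(s)^2. The derivative starts at s^2, hence its square at
  s^4, and from there on the recursion of \<open>catd\<close> evaluates the convolution.\<close>

lemma majorant_convolution:
  "(\<Sum>p\<le>K. (real (p + 1) * majorant h t (p + 1)) * (real (K - p + 1) * majorant h t (K - p + 1)))
    = (if K < 4 then 0 else 4 * h\<^sup>2 * catd (K - 3) * t ^ (K - 4))"
proof -
  let ?b = "\<lambda>p. real (p + 1) * majorant h t (p + 1)"
  have b: "?b p = (if p < 2 then 0 else h * catd (p - 2) * t ^ (p - 2))" for p
    by (auto simp: majorant_def)
  show ?thesis
  proof (cases "K < 4")
    case True
    have "?b p * ?b (K - p) = 0" for p using True unfolding b by auto
    then have "(\<Sum>p\<le>K. ?b p * ?b (K - p)) = 0" by (intro sum.neutral ballI)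
    then show ?thesis using True by (simp only: if_True)
  next
    case False
    then obtain j where K: "K = j + 4" by (metis add.commute le_Suc_ex not_less)
    \<comment> \<open>Both factors can be nonzero only for p between 2 and K - 2 = j + 2.\<close>
    have "(\<Sum>p\<le>K. ?b p * ?b (K - p)) = (\<Sum>p\<in>{2..j+2}. ?b p * ?b (K - p))"
      unfolding b by (rule sum.mono_neutral_right) (auto simp: K)
    also have "\<dots> = (\<Sum>i\<in>{0..j}. ?b (i + 2) * ?b (K - (i + 2)))"
      using sum.shift_bounds_cl_nat_ivl[of "\<lambda>p. ?b p * ?b (K - p)" 0 2 j]
      unfolding add_0 .
    also have "\<dots> = (\<Sum>i\<le>j. h\<^sup>2 * t ^ j * (catd i * catd (j - i)))"
    proof (rule sum.cong)
      fix i assume "i \<in> {..j}"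
      then have "i \<le> j" by simp
      then have "t ^ i * t ^ (j - i) = t ^ j" by (simp flip: power_add)
      then show "?b (i + 2) * ?b (K - (i + 2)) = h\<^sup>2 * t ^ j * (catd i * catd (j - i))"
        using \<open>i \<le> j\<close> unfolding b by (simp add: K power2_eq_square)
    qed auto
    also have "\<dots> = 4 * h\<^sup>2 * catd (K - 3) * t ^ (K - 4)"
      by (simp add: K flip: sum_distrib_left)
    finally show ?thesis using False by simp
  qed
qed

section \<open>Domination of the flow\<close>

text \<open>Strong induction on the degree, for all times at once: the derivative of a coefficient
  involves only lower degrees, whose bounds hold along the whole time interval. Comparison of
  derivatives and of initial values then gives the claim by the mean value inequality.\<close>

lemma norm_rescaled_le:
  fixes \<omega> :: "real ^ 'n::finite"
  assumes sol: "flow_solution \<omega> Hhat H" and \<rho>: "\<rho> > 0" and h: "h \<ge> 0"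
    and init: "\<And>k. norm (Hhat k) \<le> h * \<rho> ^ 3 / \<rho> ^ mdeg k" and "\<delta> \<ge> 0"
  shows "norm (rescaled \<omega> H \<delta> k)
    \<le> majorant h ((1 + 32 * real CARD('n) * h * \<rho> * \<delta>) / \<rho>) (mdeg k) * multinom k"
  using \<open>\<delta> \<ge> 0\<close>
proof (induction "mdeg k" arbitrary: k \<delta> rule: less_induct)
  case less
  define N where "N = real CARD('n)"
  define t where "t = (\<lambda>\<delta>. (1 + 32 * N * h * \<rho> * \<delta>) / \<rho>)"
  have N: "N \<ge> 0" by (simp add: N_def)
  have t: "t \<delta> \<ge> 0" if "\<delta> \<ge> 0" for \<delta> using that \<rho> h N by (simp add: t_def)
  have low: "H s l = 0" if "mdeg l \<le> 2" for s l
    using flow_solution_low[OF sol that] .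
  show ?case
  proof (cases "mdeg k \<le> 2")
    case True
    then show ?thesis
      using low by (simp add: rescaled_def majorant_def)
  next
    case False
    define j where "j = mdeg k - 3"
    have K: "mdeg k = j + 3" using False by (simp add: j_def)
    define \<phi> where "\<phi> = (\<lambda>s. majorant h (t s) (mdeg k) * multinom k)"
    define \<phi>' where "\<phi>' = (\<lambda>s. h * catd j / real (j + 3) * (real j * (t s) ^ (j - 1) * (32 * N * h)) * multinom k)"
    define f' where "f' = (\<lambda>s. - poisson (xi \<omega> (H s)) (H s) k * of_real (exp (freq \<omega> (mdiff k) * s)))"
    have D: "((\<lambda>s. rescaled \<omega> H s k) has_vector_derivative f' s) (at s)" for s
      unfolding f'_def by (rule rescaled_has_vector_derivative[OF sol])
    have t': "(t has_real_derivative 32 * N * h) (at s)" for s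
      unfolding t_def using \<rho> by (auto intro!: derivative_eq_intros simp: field_simps)
    have D\<phi>: "(\<phi> has_vector_derivative \<phi>' s) (at s)" for s
      unfolding \<phi>_def \<phi>'_def majorant_def K has_real_derivative_iff_has_vector_derivative[symmetric]
      by (auto intro!: derivative_eq_intros t')
    have bnd: "norm (f' s) \<le> \<phi>' s" if "s \<ge> 0" for s
    proof -
      have "norm (f' s) = norm (poisson (xi \<omega> (H s)) (H s) k) * exp (freq \<omega> (mdiff k) * s)"
        by (simp add: f'_def norm_mult)
      also have "\<dots> \<le> 2 * N * (\<Sum>p\<le>mdeg k. (real (p + 1) * majorant h (t s) (p + 1))
        * (real (mdeg k - p + 1) * majorant h (t s) (mdeg k - p + 1))) * multinom k"
        unfolding N_def
      proof (rule norm_poisson_majorant[OF that])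
        show "norm (xi \<omega> (H s) l) \<le> norm (H s l)" for l
          by (auto simp: xi_def norm_mult sigma_def sgn_if)
        show "norm (H s l) * exp (freq \<omega> (mdiff l) * s) \<le> majorant h (t s) (mdeg l) * multinom l"
          if "mdeg l < mdeg k" for l
          using less.hyps[OF that \<open>s \<ge> 0\<close>] by (simp add: rescaled_def norm_mult t_def N_def)
      qed (use low majorant_nonneg[OF h t[OF that]] in auto)
      also have "\<dots> \<le> \<phi>' s"
      \<comment> \<open>In degree 3 the bound on the bracket and \<phi>' are both 0.\<close>
      proof (cases j)
        case 0
        then show ?thesis unfolding majorant_convolution by (simp add: K \<phi>'_def)
      next
        case (Suc i)
        \<comment> \<open>Origin of the constant 32: the bracket costs 2 N times 4 from the
          convolution, while differentiating the majorant in time yields j / (j + 3), which is at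
          least 1/4 for positive j.\<close>
        have "8 * N * h\<^sup>2 * catd j * t s ^ i * multinom k * (real j + 3)
          \<le> 8 * N * h\<^sup>2 * catd j * t s ^ i * multinom k * (4 * real j)"
          using N t[OF that] multinom_nonneg[of k] less_imp_le[OF catd_pos[of j]] Suc
          by (intro mult_left_mono mult_nonneg_nonneg) auto
        then have "8 * N * h\<^sup>2 * catd j * t s ^ i * multinom k \<le> \<phi>' s"
          by (simp add: \<phi>'_def Suc field_simps power2_eq_square del: catd.simps)
        then show ?thesis unfolding majorant_convolution by (simp add: K Suc mult_ac del: catd.simps)
      qed
      finally show ?thesis .
    qed
    have "h * \<rho> ^ 3 / \<rho> ^ mdeg k = h * (1 / \<rho>) ^ j"
      using \<rho> by (simp add: K power_add field_simps)
    then have "norm (rescaled \<omega> H 0 k) \<le> h * (1 / \<rho>) ^ j"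
      using init[of k] sol by (simp add: rescaled_def flow_solution_def)
    also have "\<dots> \<le> \<phi> 0"
    proof -
      \<comment> \<open>At time 0 the majorant must exceed the Cauchy bound, which carries no
        multinomial coefficient.\<close>
      have "1 * 1 \<le> catd j / real (j + 3) * multinom k"
        using catd_ge[of j] multinom_ge_1[of k] by (intro mult_mono) auto
      then have "h * (1 / \<rho>) ^ j * 1 \<le> h * (1 / \<rho>) ^ j * (catd j / real (j + 3) * multinom k)"
        using h \<rho> by (intro mult_left_mono) auto
      also have "\<dots> = \<phi> 0" by (simp add: \<phi>_def majorant_def K t_def)
      finally show ?thesis by simp
    qed
    finally have zero: "norm (rescaled \<omega> H 0 k) \<le> \<phi> 0" .
    \<comment> \<open>The mean value inequality is applied on a nondegenerate interval; \<delta> = 0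
      is the initial bound itself.\<close>
    have "norm (rescaled \<omega> H \<delta> k - rescaled \<omega> H 0 k) \<le> \<phi> \<delta> - \<phi> 0" if "\<delta> > 0"
      by (rule differentiable_bound_general[OF that, of "\<lambda>s. rescaled \<omega> H s k" \<phi> f' \<phi>'])
         (use D D\<phi> bnd in \<open>auto intro!: has_vector_derivative_continuous continuous_at_imp_continuous_on\<close>)
    then have "norm (rescaled \<omega> H \<delta> k) \<le> \<phi> \<delta>"
      using zero less.prems norm_triangle_sub[of "rescaled \<omega> H \<delta> k" "rescaled \<omega> H 0 k"]
      by (cases "\<delta> = 0") auto
    then show ?thesis by (simp add: \<phi>_def t_def N_def)
  qed
qed

section \<open>Cauchy estimates\<close>

lemma has_sum_finite_sum:
  fixes f :: "'a \<Rightarrow> 'b \<Rightarrow> 'c::topological_comm_monoid_add"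
  assumes "finite A" "\<And>a. a \<in> A \<Longrightarrow> (f a has_sum s a) B"
  shows "((\<lambda>x. \<Sum>a\<in>A. f a x) has_sum (\<Sum>a\<in>A. s a)) B"
  using assms by (induction rule: finite_induct) (auto intro!: has_sum_add)

text \<open>A geometric sum whose ratio x satisfies x^N = 1: it vanishes unless x = 1, that is,
  unless N divides m.\<close>

lemma sum_root_of_unity_powers:
  assumes "N > 0"
  shows "(\<Sum>t<N. cis (2 * pi / real N) ^ (t * m)) = (if N dvd m then of_nat N else 0)"
proof -
  let ?x = "cis (2 * pi / real N) ^ m"
  have N: "?x ^ N = 1"
    using assms cis_multiple_2pi[of "real m"]
    by (simp add: Complex.DeMoivre power_mult[symmetric] mult_ac)
  have eq1: "?x = 1 \<longleftrightarrow> N dvd m"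
  proof
    assume "?x = 1"
    then have "cos (real m * (2 * pi / real N)) = 1"
      by (metis Complex.DeMoivre cis.simps(1) one_complex.simps(1))
    then obtain j :: int where "real m * (2 * pi / real N) = of_int j * 2 * pi"
      using cos_one_2pi_int by blast
    then have "real m = of_int j * real N" using assms by (simp add: field_simps)
    then have "int m = j * int N" by (metis of_int_eq_iff of_int_mult of_int_of_nat_eq)
    then show "N dvd m" by (metis dvd_triv_right int_dvd_int_iff)
  next
    assume "N dvd m"
    then obtain j where "m = N * j" by (elim dvdE)
    then show "?x = 1"
      using assms by (simp add: Complex.DeMoivre cis_multiple_2pi power_mult)
  qed
  have "(\<Sum>t<N. cis (2 * pi / real N) ^ (t * m)) = (\<Sum>t<N. ?x ^ t)"
    by (simp add: power_mult[symmetric] mult.commute)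
  also have "\<dots> = (if N dvd m then of_nat N else 0)"
    using N eq1 by (cases "?x = 1") (simp_all add: geometric_sum)
  finally show ?thesis .
qed

lemma norm_fs_eval_le_A_norm:
  assumes "F \<in> A_space \<rho>" "z \<in> polydisc \<rho>"
  shows "norm (fs_eval F z) \<le> A_norm \<rho> F"
proof -
  have "bdd_above ((\<lambda>z. norm (fs_eval F z)) ` polydisc \<rho>)"
    using assms by (auto simp: A_space_def bounded_iff intro: bdd_aboveI)
  then show ?thesis unfolding A_norm_def using assms(2) by (intro cSUP_upper)
qed

lemma A_norm_nonneg:
  assumes "F \<in> A_space \<rho>" "\<rho> > 0"
  shows "A_norm \<rho> F \<ge> 0"
  using norm_fs_eval_le_A_norm[OF assms(1), of 0] assms(2)
  by (simp add: polydisc_def) (metis norm_ge_zero order_trans)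

text \<open>
  Averaging over the grid of points with coordinates \<open>r\<close> times an \<open>N\<close>-th root of unity isolates the
  coefficients with exponents congruent to \<open>k\<close> modulo \<open>N\<close>; for large \<open>N\<close> all but the
  \<open>k\<close>-th one lie in the tail of an absolutely convergent series.
\<close>

lemma Cauchy_estimate_less:
  fixes F :: "'n::finite fseries"
  assumes F: "F \<in> A_space \<rho>" and r: "0 < r" "r < \<rho>"
  shows "norm (F k) * r ^ mdeg k \<le> A_norm \<rho> F"
proof (rule field_le_epsilon)
  fix \<epsilon> :: real assume \<epsilon>: "\<epsilon> > 0"
  define a where "a = (\<lambda>l. F l * of_real r ^ mdeg l)"
  define pt :: "('n + 'n \<Rightarrow> complex) \<Rightarrow> 'n zvec"
    where "pt w = ((\<chi> j. of_real r * w (Inl j)), (\<chi> j. of_real r * w (Inr j)))" for w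
  have pt_coord: "zcoord (pt w) i = of_real r * w i" for w i
    by (cases i) (simp_all add: zcoord_def pt_def)
  have pt_zmonom: "zmonom (pt w) l = of_real r ^ mdeg l * (\<Prod>i\<in>UNIV. w i ^ expo l i)" for w l
    by (simp add: zmonom_eq_prod pt_coord power_mult_distrib prod.distrib mdeg_eq_sum_expo power_sum)
  have pt_disc: "pt w \<in> polydisc \<rho>" if "\<And>i. norm (w i) = 1" for w
    using r that by (simp add: polydisc_def pt_def norm_mult)
  have eval: "((\<lambda>l. a l * (\<Prod>i\<in>UNIV. w i ^ expo l i)) has_sum fs_eval F (pt w)) UNIV"
    if "\<And>i. norm (w i) = 1" for w
  proof -
    have "(\<lambda>l. F l * zmonom (pt w) l) summable_on UNIV"
      using F pt_disc[OF that] by (simp add: A_space_def fs_converges_def)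
    then have "((\<lambda>l. F l * zmonom (pt w) l) has_sum fs_eval F (pt w)) UNIV"
      unfolding fs_eval_def by (rule has_sum_infsum)
    then show ?thesis by (simp add: pt_zmonom a_def mult.assoc)
  qed
  have "a summable_on UNIV"
    using eval[of "\<lambda>_. 1"] by (auto simp: summable_on_def)
  then have abs: "(\<lambda>l. norm (a l)) summable_on UNIV"
    by (simp only: summable_on_iff_abs_summable_on_complex)
  obtain F1 where F1: "finite F1" "dist (\<Sum>l\<in>F1. norm (a l)) (\<Sum>\<^sub>\<infinity>l. norm (a l)) \<le> \<epsilon>"
    using infsum_finite_approximation[OF abs \<epsilon>] by auto
  define F0 where "F0 = insert k F1"
  have F0: "finite F0" "k \<in> F0" using F1 by (auto simp: F0_def)
  have tail: "(\<Sum>\<^sub>\<infinity>l\<in>-F0. norm (a l)) \<le> \<epsilon>"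
  proof -
    have "(\<Sum>\<^sub>\<infinity>l\<in>-F0. norm (a l)) = (\<Sum>\<^sub>\<infinity>l. norm (a l)) - (\<Sum>l\<in>F0. norm (a l))"
      using infsum_Diff[OF abs, of F0] F0(1) by (simp add: Compl_eq_Diff_UNIV)
    moreover have "(\<Sum>l\<in>F1. norm (a l)) \<le> (\<Sum>l\<in>F0. norm (a l))"
      using F0 by (intro sum_mono2) (auto simp: F0_def)
    ultimately show ?thesis using F1(2) by (simp add: dist_real_def)
  qed
  \<comment> \<open>N exceeds every exponent occurring in \<open>F0\<close>, so distinct members of
    \<open>F0\<close> are never congruent modulo N.\<close>
  define N where "N = Suc (\<Sum>l\<in>F0. mdeg l)"
  have N: "N > 0" by (simp add: N_def)
  have expo_less: "expo l i < N" if "l \<in> F0" for l i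
  proof -
    have "mdeg l \<le> (\<Sum>l\<in>F0. mdeg l)" using that F0 by (intro member_le_sum) auto
    then show ?thesis using expo_le_mdeg[of l i] by (simp add: N_def)
  qed
  define \<zeta> where "\<zeta> = cis (2 * pi / real N)"
  define G :: "('n + 'n \<Rightarrow> nat) set" where "G = PiE UNIV (\<lambda>_. {..<N})"
  \<comment> \<open>The exponent \<open>N - expo k i\<close> represents minus
    \<open>expo k i\<close> modulo N by a natural number, so the weight undoes the phase of the k-th
    monomial.\<close>
  define \<eta> where "\<eta> g = (\<Prod>i\<in>UNIV. \<zeta> ^ (g i * (N - expo k i)))" for g :: "'n + 'n \<Rightarrow> nat"
  define c where "c l = (\<Sum>g\<in>G. \<eta> g * (\<Prod>i\<in>UNIV. (\<zeta> ^ g i) ^ expo l i))" for l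
  define X where "X = (\<Sum>g\<in>G. \<eta> g * fs_eval F (pt (\<lambda>i. \<zeta> ^ g i)))"
  have finG: "finite G" unfolding G_def by (intro finite_PiE) auto
  have norm_\<zeta>: "norm \<zeta> = 1" by (simp add: \<zeta>_def)
  have norm_\<eta>: "norm (\<eta> g) = 1" for g by (simp add: \<eta>_def norm_power norm_\<zeta> flip: prod_norm)
  have sumX: "((\<lambda>l. a l * c l) has_sum X) UNIV"
  proof -
    have "((\<lambda>l. \<Sum>g\<in>G. \<eta> g * (a l * (\<Prod>i\<in>UNIV. (\<zeta> ^ g i) ^ expo l i))) has_sum X) UNIV"
      unfolding X_def using finG
      by (intro has_sum_finite_sum has_sum_cmult_right eval) (simp_all add: norm_power norm_\<zeta>)
    then show ?thesis by (simp add: c_def sum_distrib_left mult.left_commute)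
  qed
  have c_eq: "c l = (if \<forall>i. N dvd (expo l i + (N - expo k i)) then of_nat (card G) else 0)" for l
  proof -
    have "c l = (\<Sum>g\<in>G. \<Prod>i\<in>UNIV. \<zeta> ^ (g i * (expo l i + (N - expo k i))))"
      unfolding c_def \<eta>_def
      by (simp add: prod.distrib[symmetric] power_mult[symmetric] power_add[symmetric] algebra_simps)
    \<comment> \<open>The sum over the grid factorizes into one sum over roots of unity for each
      variable.\<close>
    also have "\<dots> = (\<Prod>i\<in>UNIV. \<Sum>t<N. \<zeta> ^ (t * (expo l i + (N - expo k i))))"
      unfolding G_def by (rule prod_sum_PiE[symmetric]) auto
    also have "\<dots> = (\<Prod>i\<in>(UNIV :: ('n + 'n) set). if N dvd (expo l i + (N - expo k i)) then of_nat N else 0)"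
      unfolding \<zeta>_def sum_root_of_unity_powers[OF N] ..
    also have "\<dots> = (if \<forall>i. N dvd (expo l i + (N - expo k i)) then of_nat (card G) else 0)"
      by (auto simp: G_def card_PiE)
    finally show ?thesis .
  qed
  have c_k: "c k = of_nat (card G)"
    unfolding c_eq using less_imp_le[OF expo_less[OF F0(2)]] by simp
  have c_F0: "c l = 0" if "l \<in> F0" "l \<noteq> k" for l
  proof -
    obtain i where i: "expo l i \<noteq> expo k i" using \<open>l \<noteq> k\<close> expo_eq_iff by blast
    have lt: "expo l i < N" "expo k i < N" using that F0 expo_less by auto
    have "\<not> N dvd (expo l i + (N - expo k i))"
    proof
      assume "N dvd (expo l i + (N - expo k i))"
      then obtain q where q: "expo l i + (N - expo k i) = N * q" by (elim dvdE)
      \<comment> \<open>The sum lies strictly between 0 and 2 N, so divisibility makes it N and the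
        two exponents equal.\<close>
      have "0 < N * q" "N * q < N * 2" using lt q by linarith+
      then have "q = 1" by simp
      then show False using q lt i by simp
    qed
    then show ?thesis unfolding c_eq by auto
  qed
  have W: "real (card G) > 0" using N by (simp add: G_def card_PiE)
  have norm_c: "norm (c l) \<le> real (card G)" for l by (simp add: c_eq)
  have "((\<lambda>l. a l * c l) has_sum (X - a k * c k)) (UNIV - {k})"
    using has_sum_Diff[OF sumX has_sum_finite[of "{k}"]] by simp
  then have "((\<lambda>l. a l * c l) has_sum (X - a k * c k)) (- F0)"
    by (rule has_sum_cong_neutral[THEN iffD1, rotated -1]) (use c_F0 F0 in auto)
  moreover have "((\<lambda>l. real (card G) * norm (a l)) has_sum (real (card G) * (\<Sum>\<^sub>\<infinity>l\<in>-F0. norm (a l)))) (- F0)"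
    by (intro has_sum_cmult_right has_sum_infsum summable_on_subset_banach[OF abs]) auto
  moreover have "norm (a l * c l) \<le> real (card G) * norm (a l)" for l
    using mult_left_mono[OF norm_c[of l], of "norm (a l)"] by (simp add: norm_mult mult.commute)
  ultimately have Y: "norm (X - a k * c k) \<le> real (card G) * (\<Sum>\<^sub>\<infinity>l\<in>-F0. norm (a l))"
    by (rule norm_infsum_le)
  also have "\<dots> \<le> real (card G) * \<epsilon>" using tail by (intro mult_left_mono) auto
  finally have Y: "norm (X - a k * c k) \<le> real (card G) * \<epsilon>" .
  have "norm X \<le> real (card G) * A_norm \<rho> F"
    unfolding X_def
  proof (rule sum_norm_bound)
    fix g assume "g \<in> G"
    have "norm (fs_eval F (pt (\<lambda>i. \<zeta> ^ g i))) \<le> A_norm \<rho> F"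
      by (intro norm_fs_eval_le_A_norm[OF F] pt_disc) (simp add: norm_power norm_\<zeta>)
    then show "norm (\<eta> g * fs_eval F (pt (\<lambda>i. \<zeta> ^ g i))) \<le> A_norm \<rho> F"
      by (simp add: norm_mult norm_\<eta>)
  qed
  moreover have "norm (a k * c k) \<le> norm X + norm (X - a k * c k)"
    by (metis norm_minus_commute norm_triangle_sub)
  ultimately have "real (card G) * norm (a k) \<le> real (card G) * (A_norm \<rho> F + \<epsilon>)"
    using Y by (simp add: norm_mult c_k algebra_simps)
  then have "norm (a k) \<le> A_norm \<rho> F + \<epsilon>" using W by simp
  then show "norm (F k) * r ^ mdeg k \<le> A_norm \<rho> F + \<epsilon>"
    using r by (simp add: a_def norm_mult norm_power)
qed

text \<open>Evaluation is controlled only in the open polydisc, so the estimate is taken at radii r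
  below \<rho> and passed to the limit.\<close>

lemma Cauchy_estimate:
  fixes F :: "'n::finite fseries"
  assumes F: "F \<in> A_space \<rho>" and \<rho>: "\<rho> > 0"
  shows "norm (F k) \<le> A_norm \<rho> F / \<rho> ^ mdeg k"
proof -
  have "((\<lambda>r. norm (F k) * r ^ mdeg k) \<longlongrightarrow> norm (F k) * \<rho> ^ mdeg k) (at_left \<rho>)"
    by (intro tendsto_intros)
  moreover have "\<forall>\<^sub>F r in at_left \<rho>. norm (F k) * r ^ mdeg k \<le> A_norm \<rho> F"
    using eventually_at_left_real[OF \<rho>]
    by eventually_elim (rule Cauchy_estimate_less[OF F], auto)
  ultimately have "norm (F k) * \<rho> ^ mdeg k \<le> A_norm \<rho> F"
    by (rule tendsto_upperbound) simp
  then show ?thesis using \<rho> by (simp add: field_simps)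
qed

section \<open>Evaluation of the majorant\<close>

text \<open>A finite set of indices is enlarged to full homogeneous layers, on which the multinomial
  theorem collapses the sum to powers of \<open>l1norm z\<close>. The uniform bound on finite sums
  gives both absolute convergence and the estimate.\<close>

lemma fs_eval_le_majorant:
  fixes G :: "'n::finite fseries"
  assumes G: "\<And>k. norm (G k) \<le> b (mdeg k) * multinom k" and b: "\<And>m. b m \<ge> 0"
    and C: "\<And>D. (\<Sum>m\<le>D. b m * l1norm z ^ m) \<le> C"
  shows "fs_converges G z" "norm (fs_eval G z) \<le> C"
proof -
  let ?f = "\<lambda>k. G k * zmonom z k"
  let ?x = "\<lambda>k. \<Prod>i\<in>UNIV. norm (zcoord z i) ^ expo k i"
  have bound: "(\<Sum>k\<in>S. norm (?f k)) \<le> C" if S: "finite S" for S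
  proof -
    define D where "D = (\<Sum>k\<in>S. mdeg k)"
    have D: "mdeg k \<le> D" if "k \<in> S" for k
      unfolding D_def using S that by (intro member_le_sum) auto
    have nonneg: "b (mdeg k) * multinom k * ?x k \<ge> 0" for k
      by (intro mult_nonneg_nonneg b multinom_nonneg prod_nonneg) simp
    have "(\<Sum>k\<in>S. norm (?f k)) \<le> (\<Sum>k\<in>S. b (mdeg k) * multinom k * ?x k)"
      by (intro sum_mono)
         (simp add: norm_mult zmonom_eq_prod norm_power G mult_right_mono prod_nonneg flip: prod_norm)
    also have "\<dots> \<le> (\<Sum>k\<in>(\<Union>m\<in>{..D}. {k. mdeg k = m}). b (mdeg k) * multinom k * ?x k)"
      by (rule sum_mono2) (use D nonneg in auto)
    also have "\<dots> = (\<Sum>m\<le>D. \<Sum>k | mdeg k = m. b (mdeg k) * multinom k * ?x k)"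
      by (rule sum.UNION_disjoint) auto
    also have "\<dots> = (\<Sum>m\<le>D. b m * (\<Sum>k | mdeg k = m. multinom k * ?x k))"
      by (simp add: sum_distrib_left mult.assoc)
    also have "\<dots> = (\<Sum>m\<le>D. b m * l1norm z ^ m)"
      by (simp add: sum_multinom_power l1norm_eq_sum)
    also have "\<dots> \<le> C" by (rule C)
    finally show ?thesis .
  qed
  have abs: "(\<lambda>k. norm (?f k)) summable_on UNIV"
    by (rule nonneg_bdd_above_summable_on) (use bound in \<open>auto intro!: bdd_aboveI\<close>)
  then show "fs_converges G z"
    unfolding fs_converges_def by (rule abs_summable_summable)
  have "norm (fs_eval G z) \<le> (\<Sum>\<^sub>\<infinity>k. norm (?f k))"
    unfolding fs_eval_def by (rule norm_infsum_bound[OF abs])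
  also have "\<dots> \<le> C"
    using bound by (intro infsum_le_finite_sums[OF abs])
  finally show "norm (fs_eval G z) \<le> C" .
qed

text \<open>The threshold 1/4 is the radius of convergence of the Catalan series. The factor 16 is
  twice the bound in \<open>sum_catd_le\<close>; at s = \<rho> / (4 T) it produces 16 / 64 = 1/4,
  the constant in the final bound.\<close>

lemma sum_majorant_le:
  assumes h: "h \<ge> 0" and t: "t \<ge> 0" and s: "s \<ge> 0" and st: "s * t \<le> 1 / 4"
  shows "(\<Sum>m\<le>D. majorant h t m * s ^ m) \<le> 16 * h * s ^ 3"
proof -
  \<comment> \<open>The range is extended by 3 so that m = j + 3 runs over all j up to D.\<close>
  have "(\<Sum>m\<le>D. majorant h t m * s ^ m) \<le> (\<Sum>m\<le>D + 3. majorant h t m * s ^ m)"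
    by (rule sum_mono2) (use majorant_nonneg[OF h t] s in auto)
  also have "\<dots> = (\<Sum>m\<in>{0 + 3..D + 3}. majorant h t m * s ^ m)"
    by (rule sum.mono_neutral_right) (auto simp: majorant_def)
  also have "\<dots> = (\<Sum>j\<in>{0..D}. majorant h t (j + 3) * s ^ (j + 3))"
    by (rule sum.shift_bounds_cl_nat_ivl)
  also have "\<dots> \<le> (\<Sum>j\<in>{0..D}. h * s ^ 3 * (catd j / 4 ^ j))"
  proof (rule sum_mono)
    fix j
    have "(s * t) ^ j \<le> (1 / 4) ^ j" using s t st by (intro power_mono) auto
    moreover have "h * catd j / real (j + 3) \<le> h * catd j / 1"
      using h less_imp_le[OF catd_pos[of j]] by (intro divide_left_mono) auto
    ultimately have "h * catd j / real (j + 3) * (s * t) ^ j * s ^ 3 \<le> h * catd j / 1 * (1 / 4) ^ j * s ^ 3"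
      using h s t less_imp_le[OF catd_pos[of j]] by (intro mult_mono) auto
    then show "majorant h t (j + 3) * s ^ (j + 3) \<le> h * s ^ 3 * (catd j / 4 ^ j)"
      by (simp add: majorant_def power_mult_distrib power_add power_divide mult_ac)
  qed
  also have "\<dots> = h * s ^ 3 * (\<Sum>j\<le>D. catd j / 4 ^ j)"
    by (simp add: sum_distrib_left atMost_atLeast0)
  also have "\<dots> \<le> h * s ^ 3 * 16"
    using sum_catd_le[of D] h s by (intro mult_left_mono) auto
  finally show ?thesis by (simp add: mult_ac)
qed

lemma rescaled_bound:
  fixes \<omega> :: "real ^ 'n::finite"
  assumes \<rho>: "\<rho> > 0" and Hhat: "Hhat \<in> A_space \<rho>" "A_norm \<rho> Hhat = h * \<rho> ^ 3"
    and sol: "flow_solution \<omega> Hhat H" and \<delta>: "\<delta> \<ge> 0"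
    and z: "l1norm z \<le> \<rho> / (4 * (1 + 32 * real CARD('n) * h * \<rho> * \<delta>))"
  shows "fs_converges (rescaled \<omega> H \<delta>) z"
    and "norm (fs_eval (rescaled \<omega> H \<delta>) z)
      \<le> h * \<rho> ^ 3 / (4 * (1 + 32 * real CARD('n) * h * \<rho> * \<delta>) ^ 3)"
proof -
  define T where "T = 1 + 32 * real CARD('n) * h * \<rho> * \<delta>"
  have h: "h \<ge> 0"
    using A_norm_nonneg[OF Hhat(1) \<rho>] \<rho> by (simp add: Hhat(2) zero_le_mult_iff)
  have T: "T \<ge> 1" using h \<rho> \<delta> by (simp add: T_def)
  have s: "l1norm z \<ge> 0" by (simp add: l1norm_eq_sum sum_nonneg)
  \<comment> \<open>The boundary of the domain is exactly where s t reaches 1/4.\<close>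
  have st: "l1norm z * (T / \<rho>) \<le> 1 / 4"
    using z[folded T_def] T \<rho> by (simp add: field_simps)
  have maj: "norm (rescaled \<omega> H \<delta> k) \<le> majorant h (T / \<rho>) (mdeg k) * multinom k" for k
    unfolding T_def
    using Cauchy_estimate[OF Hhat(1) \<rho>] by (intro norm_rescaled_le[OF sol \<rho> h _ \<delta>]) (simp add: Hhat(2))
  have "l1norm z ^ 3 \<le> (\<rho> / (4 * T)) ^ 3"
    using z s by (intro power_mono) (auto simp: T_def)
  then have "16 * h * l1norm z ^ 3 \<le> 16 * h * (\<rho> / (4 * T)) ^ 3"
    using h by (intro mult_left_mono) auto
  also have "\<dots> = h * \<rho> ^ 3 / (4 * T ^ 3)"
    by (simp add: power_divide power_mult_distrib)
  finally have bound: "(\<Sum>m\<le>D. majorant h (T / \<rho>) m * l1norm z ^ m) \<le> h * \<rho> ^ 3 / (4 * T ^ 3)" for D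
    using sum_majorant_le[OF h _ s st, of D] T \<rho> by simp
  have nonneg: "majorant h (T / \<rho>) m \<ge> 0" for m
    using T \<rho> by (intro majorant_nonneg h) simp
  show "fs_converges (rescaled \<omega> H \<delta>) z"
    by (rule fs_eval_le_majorant(1)[OF maj nonneg bound])
  show "norm (fs_eval (rescaled \<omega> H \<delta>) z)
      \<le> h * \<rho> ^ 3 / (4 * (1 + 32 * real CARD('n) * h * \<rho> * \<delta>) ^ 3)"
    using fs_eval_le_majorant(2)[OF maj nonneg bound] by (simp only: T_def)
qed

section \<open>Choice of the radius and conclusion\<close>

theorem theorem2:
  fixes \<rho> h :: real
  assumes "\<rho> > 0"
  shows "\<exists>A>0. \<exists>B>0. \<forall>(\<omega> :: real ^ 'n::finite) Hhat H.
    Hhat \<in> A_space \<rho> \<inter> F_diamond \<and> A_norm \<rho> Hhat = h * \<rho> ^ 3 \<and> flow_solution \<omega> Hhat H \<longrightarrow>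
      (\<exists>g :: real \<Rightarrow> real. \<forall>\<delta>\<ge>0.
         rescaled \<omega> H \<delta> \<in> A_space (g \<delta>) \<inter> F_diamond \<and> g \<delta> \<ge> A / (1 + B * \<delta>)) \<and>
      (\<forall>\<delta>\<ge>0. \<forall>z. l1norm z \<le> \<rho> / (4 * (1 + 32 * real CARD('n) * h * \<rho> * \<delta>)) \<longrightarrow>
         fs_converges (rescaled \<omega> H \<delta>) z \<and>
         cmod (fs_eval (rescaled \<omega> H \<delta>) z)
           \<le> h * \<rho> ^ 3 / (4 * (1 + 32 * real CARD('n) * h * \<rho> * \<delta>) ^ 3))"
proof -
  define n where "n = real CARD('n)"
  \<comment> \<open>A polydisc of radius r lies in the l1-ball of radius 2 n r, and 2 n A = \<rho> /
    4.\<close>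
  define A where "A = \<rho> / (8 * n)"
  \<comment> \<open>The sign of h is not yet known here, hence the absolute value; adding 1 keeps B
    positive when h = 0.\<close>
  define B where "B = 32 * n * \<bar>h\<bar> * \<rho> + 1"
  have n: "n > 0" by (simp add: n_def)
  have A: "A > 0" using n assms by (simp add: A_def)
  have B: "B > 0" using n assms by (simp add: B_def add_nonneg_pos)
  show ?thesis
  proof (rule exI[of _ A], rule conjI[OF A], rule exI[of _ B], rule conjI[OF B], intro allI impI)
    fix \<omega> :: "real ^ 'n" and Hhat :: "'n fseries" and H
    assume *: "Hhat \<in> A_space \<rho> \<inter> F_diamond \<and> A_norm \<rho> Hhat = h * \<rho> ^ 3 \<and> flow_solution \<omega> Hhat H"
    then have Hhat: "Hhat \<in> A_space \<rho>" "A_norm \<rho> Hhat = h * \<rho> ^ 3" and sol: "flow_solution \<omega> Hhat H"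
      by auto
    note bound = rescaled_bound[OF assms Hhat sol]
    have h: "h \<ge> 0"
      using A_norm_nonneg[OF Hhat(1) assms] assms by (simp add: Hhat(2) zero_le_mult_iff)
    have "rescaled \<omega> H \<delta> \<in> A_space (A / (1 + B * \<delta>)) \<inter> F_diamond" if \<delta>: "\<delta> \<ge> 0" for \<delta>
    proof
      show "rescaled \<omega> H \<delta> \<in> F_diamond"
        using flow_solution_low[OF sol] by (simp add: F_diamond_def rescaled_def)
      have l1: "l1norm z \<le> \<rho> / (4 * (1 + 32 * real CARD('n) * h * \<rho> * \<delta>))"
        if z: "z \<in> polydisc (A / (1 + B * \<delta>))" for z :: "'n zvec"
      proof -
        have "l1norm z \<le> (\<Sum>j\<in>(UNIV :: 'n set). 2 * (A / (1 + B * \<delta>)))"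
          unfolding l1norm_def
        proof (rule sum_mono)
          fix j
          have "cmod (fst z $ j) < A / (1 + B * \<delta>)" "cmod (snd z $ j) < A / (1 + B * \<delta>)"
            using z by (simp_all add: polydisc_def)
          then show "cmod (fst z $ j) + cmod (snd z $ j) \<le> 2 * (A / (1 + B * \<delta>))" by linarith
        qed
        also have "\<dots> = \<rho> / (4 * (1 + B * \<delta>))"
          using n by (simp add: A_def n_def)
        \<comment> \<open>By now h is known to be nonnegative, so B exceeds 32 n h \<rho>.\<close>
        also have "\<dots> \<le> \<rho> / (4 * (1 + 32 * real CARD('n) * h * \<rho> * \<delta>))"
        proof (rule divide_left_mono)
          show "4 * (1 + 32 * real CARD('n) * h * \<rho> * \<delta>) \<le> 4 * (1 + B * \<delta>)"
            using h \<delta> by (simp add: B_def n_def algebra_simps)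
          show "0 < 4 * (1 + B * \<delta>) * (4 * (1 + 32 * real CARD('n) * h * \<rho> * \<delta>))"
            using B h \<delta> assms by (intro mult_pos_pos) (auto intro!: add_pos_nonneg)
        qed (use assms in simp)
        finally show ?thesis .
      qed
      show "rescaled \<omega> H \<delta> \<in> A_space (A / (1 + B * \<delta>))"
        unfolding A_space_def bounded_iff using bound[OF \<delta> l1] by blast
    qed
    then have "\<exists>g :: real \<Rightarrow> real. \<forall>\<delta>\<ge>0.
         rescaled \<omega> H \<delta> \<in> A_space (g \<delta>) \<inter> F_diamond \<and> g \<delta> \<ge> A / (1 + B * \<delta>)"
      by (intro exI[of _ "\<lambda>\<delta>. A / (1 + B * \<delta>)"]) blast
    with bound show "(\<exists>g :: real \<Rightarrow> real. \<forall>\<delta>\<ge>0.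
         rescaled \<omega> H \<delta> \<in> A_space (g \<delta>) \<inter> F_diamond \<and> g \<delta> \<ge> A / (1 + B * \<delta>)) \<and>
      (\<forall>\<delta>\<ge>0. \<forall>z. l1norm z \<le> \<rho> / (4 * (1 + 32 * real CARD('n) * h * \<rho> * \<delta>)) \<longrightarrow>
         fs_converges (rescaled \<omega> H \<delta>) z \<and>
         cmod (fs_eval (rescaled \<omega> H \<delta>) z)
           \<le> h * \<rho> ^ 3 / (4 * (1 + 32 * real CARD('n) * h * \<rho> * \<delta>) ^ 3))"
      by blast
  qed
qed

end
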